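(* There exist constants $C>0$ and $R_0\ge 3$ such that for every real $R\ge R_0$ the following online algorithm $\mathcal{A}_R$ is $\left(1+C\frac{\log R}{R}\right)$-competitive for the general\&removable online knapsack problem with a buffer of capacity $R$. Algorithm $\mathcal{A}_R$: let $m=\lfloor (R-3)/2\rfloor$ and let $\epsilon\in(0,1]$ be the real with $\log_{1+\epsilon}(1/\epsilon)=m$. Let $S$ be the set of items of size at most $\epsilon$, $M$ the set of all other items, and for $j\in\mathbb{Z}$ let $M^j=\{e\in M\mid (1+\epsilon)^j\le v(e)<(1+\epsilon)^{j+1}\}$. Start with $B_0=\emptyset$. In round $i$: set $B_i'=B_{i-1}\cup\{e_i\}$ and $B_i=\emptyset$. Go through the items $e\in B_i'\cap S$ in non-increasing order of density $v(e)/s(e)$, adding each to $B_i$, and stop this loop as soon as $s(B_i)>2$. Let $e_i^*$ be an item of maximum value in $B_i'$, $\mu_i=\lfloor\log_{1+\epsilon} v(e_i^* )\rfloor$ and $\nu_i=\lfloor \log_{1+\epsilon}(\epsilon^2 v(e_i^* ))\rfloor$. For $j=\nu_i,\dots,\mu_i$, go through the items $e\in B_i'\cap M^j$ in non-decreasing order of size and add $e$ to $B_i$ whenever $s(B_i\cap M^j)+s(e)\le 1$.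
   Context: Online knapsack problem with a resource buffer: there is a knapsack of capacity $1$ and a buffer of capacity $R\ge 1$. Items $e_1,\dots,e_n$ arrive one by one; each item $e$ has size $0<s(e)\le 1$ and value $v(e)\ge 0$; $s(B),v(B)$ denote sums over a set $B$. A deterministic online algorithm maintains buffer contents $B_0=\emptyset,B_1,\dots,B_n$, with $B_i$ chosen after seeing only $e_1,\dots,e_i$, $B_i\subseteq B_{i-1}\cup\{e_i\}$ and $s(B_i)\le R$ (removable setting). $\mathrm{ALG}(I)=\max\{v(B)\mid B\subseteq B_n,\ s(B)\le 1\}$, $\mathrm{OPT}(I)=\max\{v(B)\mid B\subseteq\{e_1,\dots,e_n\},\ s(B)\le 1\}$. "General" means values are arbitrary. An algorithm is $c$-competitive if $\mathrm{OPT}(I)\le c\cdot\mathrm{ALG}(I)$ for every input $I$. Ties in orderings and argmax choices are broken arbitrarily.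
   Formalization: The buffer capacity is R only when R ≥ 2m+3+ε; for R in [2m+3, 2m+3+ε), where the algorithm as given can exceed capacity R (e.g. R = 5), the capacity is taken to be 2m+3+ε instead. The competitive ratio is proved for all R ≥ R_0. *)

theory Defs
  imports "HOL-Analysis.Analysis"
begin

section \<open>Items, inputs, optimal packings\<close>

text \<open>The first component is only an identity: distinct items may agree in size and value.\<close>

datatype item = Item (item_id: nat) (item_size: real) (item_value: real)

definition total_size :: "item set \<Rightarrow> real" where
  "total_size B = (\<Sum>e\<in>B. item_size e)"

definition total_value :: "item set \<Rightarrow> real" where
  "total_value B = (\<Sum>e\<in>B. item_value e)"

definition density :: "item \<Rightarrow> real" where
  "density e = item_value e / item_size e"

definition valid_input :: "item list \<Rightarrow> bool" where
  "valid_input es \<longleftrightarrow>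
     distinct es \<and> (\<forall>e\<in>set es. 0 < item_size e \<and> item_size e \<le> 1 \<and> 0 \<le> item_value e)"

definition best_packing :: "item set \<Rightarrow> real" where
  "best_packing A = Max {total_value B | B. B \<subseteq> A \<and> total_size B \<le> 1}"

section \<open>Removable online algorithms with a resource buffer\<close>

text \<open>A deterministic online algorithm is a function \<open>A\<close> from the sequence of items seen so far to
  the current buffer contents, so the buffer after round \<open>i\<close> is \<open>A [e\<^sub>1, \<dots>, e\<^sub>i]\<close>.\<close>

definition removable_algorithm :: "real \<Rightarrow> (item list \<Rightarrow> item set) \<Rightarrow> bool" where
  "removable_algorithm K A \<longleftrightarrow>
     A [] = {} \<and>
     (\<forall>es e. valid_input (es @ [e]) \<longrightarrow>
        A (es @ [e]) \<subseteq> A es \<union> {e} \<and> total_size (A (es @ [e])) \<le> K)"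

definition OPT :: "item list \<Rightarrow> real" where
  "OPT es = best_packing (set es)"

definition ALG :: "(item list \<Rightarrow> item set) \<Rightarrow> item list \<Rightarrow> real" where
  "ALG A es = best_packing (A es)"

definition competitive :: "real \<Rightarrow> (item list \<Rightarrow> item set) \<Rightarrow> bool" where
  "competitive c A \<longleftrightarrow> (\<forall>es. valid_input es \<longrightarrow> OPT es \<le> c * ALG A es)"

section \<open>The algorithm\<close>

definition buf_m :: "real \<Rightarrow> int" where
  "buf_m R = \<lfloor>(R - 3) / 2\<rfloor>"

definition buf_eps :: "real \<Rightarrow> real" where
  "buf_eps R = (THE \<epsilon>. 0 < \<epsilon> \<and> \<epsilon> \<le> 1 \<and> log (1 + \<epsilon>) (1 / \<epsilon>) = real_of_int (buf_m R))"

lemma buf_eps_ex1: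
  assumes "R \<ge> 3"
  shows "\<exists>!\<epsilon>. 0 < \<epsilon> \<and> \<epsilon> \<le> 1 \<and> log (1 + \<epsilon>) (1 / \<epsilon>) = real_of_int (buf_m R)"
proof -
  define k where "k = nat (buf_m R)"
  have "buf_m R \<ge> 0" using assms by (simp add: buf_m_def)
  hence mk: "real_of_int (buf_m R) = real k" by (simp add: k_def)
  have key: "log (1 + \<epsilon>) (1 / \<epsilon>) = real k \<longleftrightarrow> \<epsilon> * (1 + \<epsilon>) ^ k = 1" if "0 < \<epsilon>" for \<epsilon> :: real
  proof -
    have "log (1 + \<epsilon>) (1 / \<epsilon>) = real k \<longleftrightarrow> 1 / \<epsilon> = (1 + \<epsilon>) powr real k"
    proof
      assume "log (1 + \<epsilon>) (1 / \<epsilon>) = real k"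
      then show "1 / \<epsilon> = (1 + \<epsilon>) powr real k"
        using that powr_log_cancel[of "1 + \<epsilon>" "1 / \<epsilon>"] by simp
    next
      assume "1 / \<epsilon> = (1 + \<epsilon>) powr real k"
      then show "log (1 + \<epsilon>) (1 / \<epsilon>) = real k" using that by simp
    qed
    also have "\<dots> \<longleftrightarrow> 1 / \<epsilon> = (1 + \<epsilon>) ^ k" using that by (simp add: powr_realpow)
    also have "\<dots> \<longleftrightarrow> \<epsilon> * (1 + \<epsilon>) ^ k = 1" using that by (auto simp: field_simps)
    finally show ?thesis .
  qed
  have "\<exists>x\<ge>0. x \<le> 1 \<and> x * (1 + x) ^ k = (1::real)"
    by (rule IVT') (auto intro!: continuous_intros)
  then obtain x :: real where x: "0 \<le> x" "x \<le> 1" "x * (1 + x) ^ k = 1" by blast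
  have "x \<noteq> 0" using x(3) by auto
  have strict: "a * (1 + a) ^ k < b * (1 + b) ^ k" if "0 < a" "a < b" for a b :: real
    using that by (intro mult_less_le_imp_less power_mono) auto
  show ?thesis unfolding mk
  proof (rule ex1I[of _ x])
    show "0 < x \<and> x \<le> 1 \<and> log (1 + x) (1 / x) = real k"
      using x \<open>x \<noteq> 0\<close> key[of x] by auto
  next
    fix y assume "0 < y \<and> y \<le> 1 \<and> log (1 + y) (1 / y) = real k"
    then have "0 < y" "y * (1 + y) ^ k = 1" using key[of y] by auto
    then show "y = x" using strict[of x y] strict[of y x] x \<open>x \<noteq> 0\<close> by (cases x y rule: linorder_cases) auto
  qed
qed

definition small_items :: "real \<Rightarrow> item set" where
  "small_items \<epsilon> = {e. item_size e \<le> \<epsilon>}"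

definition medium_class :: "real \<Rightarrow> int \<Rightarrow> item set" where
  "medium_class \<epsilon> j =
     {e. item_size e > \<epsilon> \<and> (1 + \<epsilon>) powi j \<le> item_value e \<and> item_value e < (1 + \<epsilon>) powi (j + 1)}"

fun add_small :: "item list \<Rightarrow> item set \<Rightarrow> item set" where
  "add_small [] B = B"
| "add_small (e # es) B =
     (if total_size (insert e B) > 2 then insert e B else add_small es (insert e B))"

fun add_class :: "item set \<Rightarrow> item list \<Rightarrow> item set \<Rightarrow> item set" where
  "add_class Mj [] B = B"
| "add_class Mj (e # es) B =
     add_class Mj es (if total_size (B \<inter> Mj) + item_size e \<le> 1 then insert e B else B)"

definition enumerates :: "item set \<Rightarrow> item list \<Rightarrow> bool" where
  "enumerates X es \<longleftrightarrow> distinct es \<and> set es = X"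

text \<open>One round, as a relation between \<open>B\<^bsub>i-1\<^esub>\<close>, \<open>e\<^sub>i\<close> and \<open>B\<^sub>i\<close>: the lists \<open>ss\<close>, \<open>ms j\<close> and the item
  \<open>e'\<close> range over all possible resolutions of ties.

  If the maximum value is \<open>0\<close>, then \<open>log _ 0 = 0\<close> makes the second loop visit the class of index
  \<open>0\<close> only, which then contains no item of the buffer; so nothing is added, as for every other
  convention about \<open>log 0\<close>.\<close>

definition AR_step :: "real \<Rightarrow> item set \<Rightarrow> item \<Rightarrow> item set \<Rightarrow> bool" where
  "AR_step R B e C \<longleftrightarrow>
     (let \<epsilon> = buf_eps R; B' = B \<union> {e} in
      \<exists>ss ms e'.
        enumerates (B' \<inter> small_items \<epsilon>) ss \<and>
        sorted_wrt (\<lambda>x y. density x \<ge> density y) ss \<and>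
        e' \<in> B' \<and> (\<forall>x\<in>B'. item_value x \<le> item_value e') \<and>
        (\<forall>j. enumerates (B' \<inter> medium_class \<epsilon> j) (ms j) \<and>
             sorted_wrt (\<lambda>x y. item_size x \<le> item_size y) (ms j)) \<and>
        (let \<mu> = \<lfloor>log (1 + \<epsilon>) (item_value e')\<rfloor>;
             \<nu> = \<lfloor>log (1 + \<epsilon>) (\<epsilon>\<^sup>2 * item_value e')\<rfloor>
         in C = fold (\<lambda>j. add_class (medium_class \<epsilon> j) (ms j)) [\<nu>..\<mu>] (add_small ss {})))"

definition is_AR :: "real \<Rightarrow> (item list \<Rightarrow> item set) \<Rightarrow> bool" where
  "is_AR R A \<longleftrightarrow>
     A [] = {} \<and>
     (\<forall>es e. valid_input (es @ [e]) \<longrightarrow> AR_step R (A es) e (A (es @ [e])))"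

text \<open>\<open>is_AR\<close> does not itself restrict the buffer load. With \<open>m = buf_m R\<close> and \<open>\<epsilon> = buf_eps R\<close>, the small
  items contribute at most \<open>2 + \<epsilon>\<close>, and each of the \<open>2 * m + 1\<close> value classes at most \<open>1\<close>. The resulting
  bound \<open>2 * m + 3 + \<epsilon>\<close> is at most \<open>R\<close> unless \<open>R\<close> lies in the interval \<open>[2 * m + 3, 2 * m + 3 + \<epsilon>)\<close>;
  there (e.g. for every odd integer \<open>R \<ge> 5\<close>) the load can really exceed \<open>R\<close>, by at most \<open>\<epsilon>\<close>.\<close>

subsection \<open>The algorithm exists\<close>

lemma enumerates_sorted_ex:
  fixes f :: "item \<Rightarrow> real"
  assumes "finite X"
  shows "\<exists>xs. enumerates X xs \<and> sorted_wrt (\<lambda>x y. f x \<le> f y) xs"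
proof -
  obtain xs where xs: "set xs = X" "distinct xs" using finite_distinct_list[OF assms] by blast
  have "sorted (map f (sort_key f xs))" by (rule sorted_sort_key)
  hence "sorted_wrt (\<lambda>x y. f x \<le> f y) (sort_key f xs)" by (simp add: sorted_wrt_map)
  with xs show ?thesis unfolding enumerates_def by (intro exI[of _ "sort_key f xs"]) auto
qed

lemma add_small_subset: "add_small es B \<subseteq> B \<union> set es"
proof (induction es arbitrary: B)
  case (Cons e es)
  show ?case using Cons[of "insert e B"] by auto
qed simp

lemma add_class_subset: "add_class Mj es B \<subseteq> B \<union> set es"
proof (induction es arbitrary: B)
  case (Cons e es)
  show ?case using Cons[of B] Cons[of "insert e B"] by auto
qed simp

lemma AR_step_subset:
  assumes "AR_step R B e C"
  shows "C \<subseteq> B \<union> {e}"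
proof -
  have fold_sub: "fold (\<lambda>j. add_class (F j) (ms j)) js D \<subseteq> X"
    if "\<And>j. set (ms j) \<subseteq> X" "D \<subseteq> X" for F ms and js :: "int list" and D X
    using that(2)
  proof (induction js arbitrary: D)
    case (Cons j js)
    have "add_class (F j) (ms j) D \<subseteq> X"
      using add_class_subset[of "F j" "ms j" D] that(1)[of j] Cons.prems by blast
    from Cons.IH[OF this] show ?case by simp
  qed simp
  obtain ss ms \<mu> \<nu> where
    ss: "set ss \<subseteq> B \<union> {e}" and ms: "\<And>j. set (ms j) \<subseteq> B \<union> {e}"
    and C: "C = fold (\<lambda>j. add_class (medium_class (buf_eps R) j) (ms j)) [\<nu>..\<mu>] (add_small ss {})"
    using assms unfolding AR_step_def Let_def enumerates_def by blast
  show ?thesis unfolding C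
    by (rule fold_sub[OF ms]) (use add_small_subset[of ss "{}"] ss in blast)
qed

lemma AR_step_ex:
  assumes "finite B"
  shows "\<exists>C. AR_step R B e C"
proof -
  define B' where "B' = B \<union> {e}"
  have fin: "finite B'" using assms by (simp add: B'_def)
  obtain ss where ss: "enumerates (B' \<inter> small_items (buf_eps R)) ss"
    "sorted_wrt (\<lambda>x y. - density x \<le> - density y) ss"
    using enumerates_sorted_ex[of "B' \<inter> small_items (buf_eps R)" "\<lambda>x. - density x"] fin by blast
  have "\<forall>j. \<exists>xs. enumerates (B' \<inter> medium_class (buf_eps R) j) xs \<and>
      sorted_wrt (\<lambda>x y. item_size x \<le> item_size y) xs"
    using enumerates_sorted_ex fin by blast
  then obtain ms where ms: "\<forall>j. enumerates (B' \<inter> medium_class (buf_eps R) j) (ms j) \<and>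
      sorted_wrt (\<lambda>x y. item_size x \<le> item_size y) (ms j)"
    by metis
  have "Max (item_value ` B') \<in> item_value ` B'" using fin by (intro Max_in) (auto simp: B'_def)
  then obtain e' where "e' \<in> B'" "item_value e' = Max (item_value ` B')" by auto
  hence e': "e' \<in> B'" "\<forall>x\<in>B'. item_value x \<le> item_value e'" using fin by auto
  show ?thesis
    unfolding AR_step_def Let_def B'_def[symmetric]
    using ss ms e' by (simp only: neg_le_iff_le) blast
qed

lemma is_AR_ex: "\<exists>A. is_AR R A"
proof -
  define A where "A = foldl (\<lambda>B e. SOME C. AR_step R B e C) {}"
  have fin: "finite (A es)" for es
  proof (induction es rule: rev_induct)
    case (snoc e es)
    have "AR_step R (A es) e (A (es @ [e]))"
      unfolding A_def using someI_ex[OF AR_step_ex[OF snoc[unfolded A_def]]] by simp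
    from finite_subset[OF AR_step_subset[OF this]] snoc show ?case by simp
  qed (simp add: A_def)
  have "AR_step R (A es) e (A (es @ [e]))" for es e
    unfolding A_def using someI_ex[OF AR_step_ex[OF fin[unfolded A_def]]] by simp
  thus ?thesis unfolding is_AR_def by (intro exI[of _ A]) (simp add: A_def)
qed

end

theory Submission
  imports Defs "HOL-Real_Asymp.Real_Asymp"
begin

text \<open>Greedy selections survive rounds: an item discarded long ago is still no denser than the small
  items kept now, which fill more than the knapsack, or still no smaller than the kept items of its
  value class, to which it cannot be added. A class may lose this property only when it lies below
  \<open>\<nu>\<^sub>i\<close> in some round; its items are then worth at most \<open>\<epsilon>\<^sup>2 OPT\<close> each, and a packing contains fewer
  than \<open>1 / \<epsilon>\<close> of them.

  So an optimal packing can be copied from the buffer. In each remaining class, exchange its items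
  for equally many kept ones of no larger total size, which costs a factor \<open>1 + \<epsilon>\<close>. Fill what is left
  of the knapsack with kept small items up to a gap of \<open>\<epsilon>\<close>, which costs \<open>O(\<epsilon>) OPT\<close>, since the density
  of a discarded small item is at most \<open>2 OPT\<close>. Hence the ratio is \<open>1 + O(\<epsilon>)\<close>, and
  \<open>\<epsilon> (1 + \<epsilon>)^m = 1\<close> gives \<open>\<epsilon> \<le> 8 ln R / R\<close>.\<close>

section \<open>Sizes and values of item sets, and best packings\<close>

lemma total_size_empty [simp]: "total_size {} = 0"
  by (simp add: total_size_def)

lemma total_size_insert:
  assumes "finite B" "e \<notin> B"
  shows "total_size (insert e B) = item_size e + total_size B"
  using assms by (simp add: total_size_def)

lemma total_size_mono:
  assumes "finite B" "A \<subseteq> B" "\<forall>x\<in>B. 0 < item_size x"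
  shows "total_size A \<le> total_size B"
  unfolding total_size_def using assms by (intro sum_mono2) (auto intro: less_imp_le)

lemma total_size_Un_disjoint:
  assumes "finite A" "finite B" "A \<inter> B = {}"
  shows "total_size (A \<union> B) = total_size A + total_size B"
  unfolding total_size_def using assms by (rule sum.union_disjoint)

lemma total_value_Un_disjoint:
  assumes "finite A" "finite B" "A \<inter> B = {}"
  shows "total_value (A \<union> B) = total_value A + total_value B"
  unfolding total_value_def using assms by (rule sum.union_disjoint)

lemma total_value_mono:
  assumes "finite B" "A \<subseteq> B" "\<forall>x\<in>B. 0 \<le> item_value x"
  shows "total_value A \<le> total_value B"
  unfolding total_value_def using assms by (intro sum_mono2) auto

lemma best_packing_ge:
  assumes "finite A" "B \<subseteq> A" "total_size B \<le> 1"
  shows "total_value B \<le> best_packing A"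
  unfolding best_packing_def
proof (rule Max_ge)
  have "{total_value B |B. B \<subseteq> A \<and> total_size B \<le> 1} \<subseteq> total_value ` Pow A" by auto
  then show "finite {total_value B |B. B \<subseteq> A \<and> total_size B \<le> 1}"
    using assms(1) finite_subset by fast
qed (use assms in auto)

lemma best_packing_attained:
  assumes "finite A"
  obtains B where "B \<subseteq> A" "total_size B \<le> 1" "total_value B = best_packing A"
proof -
  let ?V = "{total_value B |B. B \<subseteq> A \<and> total_size B \<le> 1}"
  have "?V \<subseteq> total_value ` Pow A" by auto
  then have "finite ?V" using assms finite_subset by fast
  moreover have "total_value {} \<in> ?V" by force
  ultimately have "Max ?V \<in> ?V" by (intro Max_in) auto
  with that show thesis by (auto simp: best_packing_def)
qed

section \<open>The selections made by the two loops of a round\<close>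

text \<open>\<open>U\<close> holds the items on offer, in one round or over all rounds so far, and
  \<open>H\<close> those kept. A load above \<open>2\<close> is demanded only if something was
  discarded, since a loop that runs out of items may leave a light \<open>H\<close>.\<close>

definition density_greedy :: "item set \<Rightarrow> item set \<Rightarrow> bool" where
  "density_greedy U H \<longleftrightarrow> (\<forall>z\<in>U - H. (\<forall>y\<in>H. density z \<le> density y) \<and> 2 < total_size H)"

definition size_greedy :: "item set \<Rightarrow> item set \<Rightarrow> bool" where
  "size_greedy U G \<longleftrightarrow> (\<forall>z\<in>U - G. (\<forall>y\<in>G. item_size y \<le> item_size z) \<and> 1 < total_size G + item_size z)"

lemma superset_add_small: "B \<subseteq> add_small xs B"
proof (induction xs arbitrary: B)
  case (Cons e es)
  show ?case using Cons[of "insert e B"] by auto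
qed simp

text \<open>The induction carries an accumulator \<open>B\<close> that is at least as dense as
  everything pending. The second conjunct records the stopping rule: items strictly denser than
  \<open>w\<close> were already in the accumulator when \<open>w\<close> was added, and its load was
  then at most \<open>2\<close>.\<close>

lemma add_small_greedy:
  assumes "finite B" "total_size B \<le> 2" "distinct xs" "set xs \<inter> B = {}"
    "sorted_wrt (\<lambda>x y. density x \<ge> density y) xs"
    "\<forall>b\<in>B. \<forall>x\<in>set xs. density x \<le> density b"
    "\<forall>x\<in>B \<union> set xs. 0 < item_size x" "\<forall>x\<in>set xs. item_size x \<le> \<epsilon>" "0 \<le> \<epsilon>"
  shows "density_greedy (B \<union> set xs) (add_small xs B)
    \<and> (\<forall>w\<in>add_small xs B - B. total_size {y \<in> add_small xs B. density w < density y} \<le> 2)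
    \<and> total_size (add_small xs B) \<le> 2 + \<epsilon>"
  using assms
proof (induction xs arbitrary: B)
  case Nil
  then show ?case by (auto simp: density_greedy_def)
next
  case (Cons e es)
  have eB: "e \<notin> B" using Cons.prems by auto
  show ?case
  proof (cases "total_size (insert e B) > 2")
    case True
    have "total_size {y \<in> insert e B. density e < density y} \<le> total_size B"
      using Cons.prems by (intro total_size_mono) auto
    with True Cons.prems eB show ?thesis
      by (auto simp: density_greedy_def total_size_insert)
  next
    case False
    let ?H = "add_small es (insert e B)"
    have IH: "density_greedy (insert e B \<union> set es) ?H
      \<and> (\<forall>w\<in>?H - insert e B. total_size {y \<in> ?H. density w < density y} \<le> 2)
      \<and> total_size ?H \<le> 2 + \<epsilon>"
      using Cons.prems False by (intro Cons.IH) auto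
    have "\<forall>y\<in>insert e (set es). density y \<le> density e" using Cons.prems(5) by simp
    then have "{y \<in> ?H. density e < density y} \<subseteq> B"
      using add_small_subset[of es "insert e B"] by fastforce
    then have "total_size {y \<in> ?H. density e < density y} \<le> total_size B"
      using Cons.prems(1,7) by (intro total_size_mono) auto
    also have "\<dots> \<le> 2" by (rule Cons.prems(2))
    finally have "total_size {y \<in> ?H. density e < density y} \<le> 2" .
    with IH False show ?thesis by auto
  qed
qed

lemma add_class_id:
  assumes "\<forall>x\<in>set xs. 1 < total_size (B \<inter> F) + item_size x"
  shows "add_class F xs B = B"
  using assms by (induction xs) auto

text \<open>Sizes are sorted, so once an item does not fit, no later one does: the loop effectively
  stops there, and every discarded item is at least as large as the kept ones.\<close>

lemma add_class_greedy:
  assumes "finite B" "B \<subseteq> F" "set xs \<subseteq> F" "total_size B \<le> 1" "distinct xs" "set xs \<inter> B = {}"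
    "sorted_wrt (\<lambda>x y. item_size x \<le> item_size y) xs"
    "\<forall>b\<in>B. \<forall>x\<in>set xs. item_size b \<le> item_size x"
  shows "size_greedy (B \<union> set xs) (add_class F xs B) \<and> total_size (add_class F xs B) \<le> 1"
  using assms
proof (induction xs arbitrary: B)
  case Nil
  then show ?case by (auto simp: size_greedy_def)
next
  case (Cons e es)
  have BF: "B \<inter> F = B" using Cons.prems by auto
  show ?case
  proof (cases "total_size B + item_size e \<le> 1")
    case True
    have "size_greedy (insert e B \<union> set es) (add_class F es (insert e B))
      \<and> total_size (add_class F es (insert e B)) \<le> 1"
      using Cons.prems True by (intro Cons.IH) (auto simp: total_size_insert)
    with True BF show ?thesis by simp
  next
    case False
    then have "\<forall>x\<in>set (e # es). 1 < total_size (B \<inter> F) + item_size x"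
      unfolding BF using Cons.prems(7) by auto
    moreover from add_class_id[OF this] have "add_class F (e # es) B = B" .
    ultimately show ?thesis
      using Cons.prems(4,8) BF by (auto simp: size_greedy_def)
  qed
qed

text \<open>The loop inspects the buffer only through its intersection with \<open>F\<close>, so a
  part \<open>D\<close> outside \<open>F\<close> is merely carried along.\<close>

lemma add_class_Un_disjoint:
  assumes "set xs \<subseteq> F" "D \<inter> F = {}"
  shows "add_class F xs (D \<union> X) = D \<union> add_class F xs X"
  using assms(1)
proof (induction xs arbitrary: X)
  case (Cons e es)
  have "(D \<union> X) \<inter> F = X \<inter> F" using assms(2) by auto
  then show ?case using Cons.IH[of X] Cons.IH[of "insert e X"] Cons.prems by simp
qed simp

text \<open>By disjointness no class loop affects the load seen by another, so they split into
  independent runs from the empty set.\<close>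

lemma fold_add_class:
  assumes "distinct js" "disjoint_family F" "\<And>j. set (ms j) \<subseteq> F j" "\<And>j. D \<inter> F j = {}"
  shows "fold (\<lambda>j. add_class (F j) (ms j)) js D = D \<union> (\<Union>j\<in>set js. add_class (F j) (ms j) {})"
  using assms(1)
proof (induction js rule: rev_induct)
  case (snoc k js)
  have sub: "add_class (F j) (ms j) {} \<subseteq> F j" for j
    using add_class_subset[of "F j" "ms j" "{}"] assms(3)[of j] by blast
  let ?X = "D \<union> (\<Union>j\<in>set js. add_class (F j) (ms j) {})"
  have "F j \<inter> F k = {}" if "j \<in> set js" for j
    using assms(2) snoc.prems that unfolding disjoint_family_on_def by (metis UNIV_I distinct_append
      disjoint_iff list.set_intros(1))
  then have "?X \<inter> F k = {}" using assms(4)[of k] sub by blast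
  then have "add_class (F k) (ms k) (?X \<union> {}) = ?X \<union> add_class (F k) (ms k) {}"
    by (intro add_class_Un_disjoint assms(3))
  with snoc show ?case by auto
qed simp

section \<open>Value classes and the analysis of one round\<close>

text \<open>Turns the two value bounds into a single index, which makes disjointness immediate. The
  positivity conjunct keeps worthless items, for which \<open>log\<close> defaults to
  \<open>0\<close>, out of the class of index \<open>0\<close>.\<close>

lemma medium_class_iff:
  assumes "0 < \<epsilon>"
  shows "x \<in> medium_class \<epsilon> j \<longleftrightarrow>
    \<epsilon> < item_size x \<and> 0 < item_value x \<and> j = \<lfloor>log (1 + \<epsilon>) (item_value x)\<rfloor>"
proof (cases "0 < item_value x")
  case True
  have pw: "(1 + \<epsilon>) powi k = (1 + \<epsilon>) powr real_of_int k" for k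
    using assms by (simp add: powr_real_of_int')
  have "(1 + \<epsilon>) powi j \<le> item_value x \<longleftrightarrow> real_of_int j \<le> log (1 + \<epsilon>) (item_value x)"
    unfolding pw using assms True by (simp add: le_log_iff)
  moreover have "item_value x < (1 + \<epsilon>) powi (j + 1) \<longleftrightarrow> log (1 + \<epsilon>) (item_value x) < real_of_int j + 1"
    unfolding pw using assms True by (simp add: log_less_iff)
  ultimately show ?thesis using True
    by (auto simp: medium_class_def floor_eq_iff eq_commute[of j])
next
  case False
  moreover have "0 < (1 + \<epsilon>) powi j" using assms by simp
  ultimately show ?thesis by (auto simp: medium_class_def)
qed

lemma disjoint_medium_class: "0 < \<epsilon> \<Longrightarrow> disjoint_family (medium_class \<epsilon>)"
  by (auto simp: disjoint_family_on_def medium_class_iff)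

lemma small_medium_disjoint: "small_items \<epsilon> \<inter> medium_class \<epsilon> j = {}"
  by (auto simp: small_items_def medium_class_def)

lemma buf_eps_props:
  assumes "R \<ge> 3"
  shows "0 < buf_eps R" "buf_eps R \<le> 1" "log (1 + buf_eps R) (1 / buf_eps R) = real_of_int (buf_m R)"
  using theI'[OF buf_eps_ex1[OF assms]] unfolding buf_eps_def[symmetric] by auto

text \<open>The defining equation of \<open>buf_eps R\<close> makes the logarithm of
  \<open>\<epsilon>\<^sup>2\<close> the integer \<open>- 2 * buf_m R\<close>, so rounding commutes
  with the shift.\<close>

lemma floor_log_eps_sq:
  assumes "R \<ge> 3" "0 < v"
  defines "\<epsilon> \<equiv> buf_eps R"
  shows "\<lfloor>log (1 + \<epsilon>) (\<epsilon>\<^sup>2 * v)\<rfloor> = \<lfloor>log (1 + \<epsilon>) v\<rfloor> - 2 * buf_m R"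
proof -
  note eps = buf_eps_props[OF assms(1), folded \<epsilon>_def]
  have "log (1 + \<epsilon>) \<epsilon> = - real_of_int (buf_m R)"
    using eps by (simp add: log_divide)
  then have "log (1 + \<epsilon>) (\<epsilon>\<^sup>2 * v) = log (1 + \<epsilon>) v - real_of_int (2 * buf_m R)"
    using eps assms(2) by (simp add: log_mult log_nat_power)
  then show ?thesis by (metis floor_diff_of_int)
qed

text \<open>The last claim takes any upper bound \<open>V\<close> on the values instead of the
  maximum of the round, so that the same classes can be followed through all rounds. A class whose
  upper end exceeds \<open>\<epsilon>\<^sup>2 * V\<close> is either visited or has no item at
  hand.\<close>

lemma AR_step_greedy:
  fixes R :: real and B :: "item set" and e :: item
  defines "\<epsilon> \<equiv> buf_eps R" and "B' \<equiv> B \<union> {e}"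
  assumes R: "R \<ge> 3" and step: "AR_step R B e C" and fin: "finite B"
    and pos: "\<forall>x\<in>B'. 0 < item_size x" and nonneg: "\<forall>x\<in>B'. 0 \<le> item_value x"
  shows "total_size C \<le> 2 * real_of_int (buf_m R) + 3 + \<epsilon>"
    and "density_greedy (B' \<inter> small_items \<epsilon>) (C \<inter> small_items \<epsilon>)"
    and "\<forall>w\<in>C \<inter> small_items \<epsilon>. total_size {y \<in> C \<inter> small_items \<epsilon>. density w < density y} \<le> 2"
    and "total_size (C \<inter> medium_class \<epsilon> j) \<le> 1"
    and "\<lbrakk>\<forall>x\<in>B'. item_value x \<le> V; \<epsilon>\<^sup>2 * V < (1 + \<epsilon>) powi (j + 1)\<rbrakk>
      \<Longrightarrow> size_greedy (B' \<inter> medium_class \<epsilon> j) (C \<inter> medium_class \<epsilon> j)"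
proof -
  note eps = buf_eps_props[OF R, folded \<epsilon>_def]
  let ?S = "small_items \<epsilon>" and ?M = "medium_class \<epsilon>"
  have finB': "finite B'" using fin by (simp add: B'_def)
  obtain ss ms e' where ss: "enumerates (B' \<inter> ?S) ss" "sorted_wrt (\<lambda>x y. density x \<ge> density y) ss"
    and e': "e' \<in> B'" "\<forall>x\<in>B'. item_value x \<le> item_value e'"
    and ms: "\<And>j. enumerates (B' \<inter> ?M j) (ms j)" "\<And>j. sorted_wrt (\<lambda>x y. item_size x \<le> item_size y) (ms j)"
    and C0: "C = fold (\<lambda>j. add_class (?M j) (ms j))
      [\<lfloor>log (1 + \<epsilon>) (\<epsilon>\<^sup>2 * item_value e')\<rfloor>..\<lfloor>log (1 + \<epsilon>) (item_value e')\<rfloor>] (add_small ss {})"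
    using step unfolding AR_step_def Let_def B'_def \<epsilon>_def by blast
  define \<mu> where "\<mu> = \<lfloor>log (1 + \<epsilon>) (item_value e')\<rfloor>"
  define \<nu> where "\<nu> = \<lfloor>log (1 + \<epsilon>) (\<epsilon>\<^sup>2 * item_value e')\<rfloor>"
  define H where "H = add_small ss {}"
  define G where "G j = add_class (?M j) (ms j) {}" for j
  have set_ss: "set ss = B' \<inter> ?S" and set_ms: "set (ms j) = B' \<inter> ?M j" for j
    using ss(1) ms(1)[of j] by (auto simp: enumerates_def)
  have HS: "H \<subseteq> B' \<inter> ?S" unfolding H_def using add_small_subset[of ss "{}"] set_ss by auto
  have GM: "G j \<subseteq> B' \<inter> ?M j" for j
    unfolding G_def using add_class_subset[of "?M j" "ms j" "{}"] set_ms by auto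
  have dM: "?M i \<inter> ?M k = {}" if "i \<noteq> k" for i k
    using disjoint_medium_class[OF eps(1)] that by (auto simp: disjoint_family_on_def)
  have C: "C = H \<union> (\<Union>j\<in>{\<nu>..\<mu>}. G j)"
  proof -
    have "H \<inter> ?M k = {}" for k using HS small_medium_disjoint[of \<epsilon>] by blast
    moreover have "set (ms k) \<subseteq> ?M k" for k using set_ms by blast
    ultimately have "fold (\<lambda>j. add_class (?M j) (ms j)) [\<nu>..\<mu>] H
        = H \<union> (\<Union>j\<in>set [\<nu>..\<mu>]. add_class (?M j) (ms j) {})"
      using disjoint_medium_class[OF eps(1)] by (intro fold_add_class) simp_all
    then show ?thesis
      unfolding C0 H_def[symmetric] \<mu>_def[symmetric] \<nu>_def[symmetric] G_def by simp
  qed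
  have CS: "C \<inter> ?S = H" unfolding C using HS GM small_medium_disjoint[of \<epsilon>] by blast
  have CM: "C \<inter> ?M j = (if j \<in> {\<nu>..\<mu>} then G j else {})" for j
  proof -
    have G_eq: "k = j" if "x \<in> G k" "x \<in> ?M j" for k x
    proof (rule ccontr)
      assume "k \<noteq> j"
      from dM[OF this] GM[of k] that show False by blast
    qed
    have "H \<inter> ?M j = {}" using HS small_medium_disjoint[of \<epsilon>] by blast
    then have "x \<in> C \<inter> ?M j \<longleftrightarrow> x \<in> G j \<and> j \<in> {\<nu>..\<mu>}" for x
      unfolding C using GM[of j] G_eq[of x] by blast
    then show ?thesis by auto
  qed
  have small: "density_greedy ({} \<union> set ss) H \<and> (\<forall>w\<in>H - {}. total_size {y \<in> H. density w < density y} \<le> 2)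
    \<and> total_size H \<le> 2 + \<epsilon>"
    unfolding H_def
  proof (rule add_small_greedy)
    show "\<forall>x\<in>set ss. item_size x \<le> \<epsilon>" "\<forall>x\<in>{} \<union> set ss. 0 < item_size x"
      unfolding set_ss using pos by (auto simp: small_items_def)
    show "distinct ss" using ss(1) by (simp add: enumerates_def)
  qed (use ss(2) eps(1) in auto)
  have med: "size_greedy ({} \<union> set (ms j)) (G j) \<and> total_size (G j) \<le> 1" for j
    unfolding G_def
  proof (rule add_class_greedy)
    show "set (ms j) \<subseteq> ?M j" using set_ms by blast
    show "distinct (ms j)" using ms(1) by (simp add: enumerates_def)
  qed (use ms(2) in auto)
  show "density_greedy (B' \<inter> ?S) (C \<inter> ?S)"
    "\<forall>w\<in>C \<inter> ?S. total_size {y \<in> C \<inter> ?S. density w < density y} \<le> 2"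
    unfolding CS using small set_ss by auto
  show "total_size (C \<inter> ?M j) \<le> 1" using CM[of j] med[of j] by auto
  have m0: "0 \<le> buf_m R" using R by (simp add: buf_m_def)
  have "card {\<nu>..\<mu>} \<le> 2 * nat (buf_m R) + 1"
  proof (cases "item_value e' = 0")
    case False
    then have "\<nu> = \<mu> - 2 * buf_m R"
      using floor_log_eps_sq[OF R, of "item_value e'"] nonneg e'(1)
      unfolding \<mu>_def \<nu>_def \<epsilon>_def by force
    then show ?thesis using m0 by simp
  \<comment> \<open>All values at hand vanish; \<open>log\<close> of \<open>0\<close> is
    \<open>0\<close>, so both ends are \<open>0\<close> and a single class is visited.\<close>
  qed (simp add: \<mu>_def \<nu>_def)
  moreover have "total_size (\<Union>j\<in>{\<nu>..\<mu>}. G j) = (\<Sum>j\<in>{\<nu>..\<mu>}. total_size (G j))"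
    unfolding total_size_def
  proof (rule sum.UNION_disjoint)
    show "\<forall>i\<in>{\<nu>..\<mu>}. finite (G i)" using GM finB' by (meson finite_Int finite_subset)
    show "\<forall>i\<in>{\<nu>..\<mu>}. \<forall>j\<in>{\<nu>..\<mu>}. i \<noteq> j \<longrightarrow> G i \<inter> G j = {}"
      using GM dM by blast
  qed simp
  moreover have "(\<Sum>j\<in>{\<nu>..\<mu>}. total_size (G j)) \<le> real (card {\<nu>..\<mu>}) * 1"
    using med by (intro sum_bounded_above) auto
  ultimately have "total_size (\<Union>j\<in>{\<nu>..\<mu>}. G j) \<le> real (2 * nat (buf_m R) + 1)"
    by linarith
  then have "total_size (\<Union>j\<in>{\<nu>..\<mu>}. G j) \<le> 2 * real_of_int (buf_m R) + 1"
    using m0 by simp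
  moreover have "total_size C = total_size H + total_size (\<Union>j\<in>{\<nu>..\<mu>}. G j)"
    unfolding C
  proof (rule total_size_Un_disjoint)
    show "finite H" using HS finB' by (meson finite_Int finite_subset)
    have "(\<Union>j\<in>{\<nu>..\<mu>}. G j) \<subseteq> B'" using GM by blast
    then show "finite (\<Union>j\<in>{\<nu>..\<mu>}. G j)" using finB' finite_subset by blast
    show "H \<inter> (\<Union>j\<in>{\<nu>..\<mu>}. G j) = {}" using HS GM small_medium_disjoint[of \<epsilon>] by blast
  qed
  ultimately show "total_size C \<le> 2 * real_of_int (buf_m R) + 3 + \<epsilon>"
    using small by linarith
  show "size_greedy (B' \<inter> ?M j) (C \<inter> ?M j)"
    if V: "\<forall>x\<in>B'. item_value x \<le> V" "\<epsilon>\<^sup>2 * V < (1 + \<epsilon>) powi (j + 1)"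
  proof (cases "B' \<inter> ?M j = {}")
    case True
    then show ?thesis by (simp add: size_greedy_def)
  next
    case False
    then obtain x where x: "x \<in> B'" "0 < item_value x" "j = \<lfloor>log (1 + \<epsilon>) (item_value x)\<rfloor>"
      using medium_class_iff[OF eps(1)] by blast
    have ve: "0 < item_value e'" using x e'(2) by fastforce
    have "j \<le> \<mu>"
      unfolding \<mu>_def x(3) using x e'(2) ve eps by (intro floor_mono) simp
    moreover have "\<nu> \<le> j"
    proof -
      \<comment> \<open>The maximum of this round may be smaller than \<open>V\<close>, which only
        lowers \<open>\<nu>\<close>.\<close>
      have "\<epsilon>\<^sup>2 * item_value e' \<le> \<epsilon>\<^sup>2 * V" using V e'(1) by (simp add: mult_left_mono)
      then have "\<epsilon>\<^sup>2 * item_value e' < (1 + \<epsilon>) powr real_of_int (j + 1)"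
        using order.strict_trans1[OF _ V(2)] eps(1) by (subst powr_real_of_int') auto
      then have "log (1 + \<epsilon>) (\<epsilon>\<^sup>2 * item_value e') < real_of_int (j + 1)"
        using eps(1) ve by (subst log_less_iff) auto
      then show ?thesis unfolding \<nu>_def by linarith
    qed
    ultimately show ?thesis using CM[of j] med[of j] set_ms[of j] by auto
  qed
qed

section \<open>Survival of greedy selections over the rounds\<close>

text \<open>The minimality condition \<open>min\<close> (the loop stops as soon as the load exceeds \<open>2\<close>) keeps the new
  item out if it is less dense than an item discarded earlier.\<close>

lemma density_greedy_step:
  assumes "density_greedy U B" and "density_greedy D H" and "B \<subseteq> D" "D \<subseteq> insert e B" "H \<subseteq> D"
    and min: "\<forall>w\<in>H. total_size {y \<in> H. density w < density y} \<le> 2"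
    and fin: "finite D" and pos: "\<forall>x\<in>D. 0 < item_size x"
  shows "density_greedy (U \<union> D) H"
  unfolding density_greedy_def
proof (intro ballI)
  fix z assume z: "z \<in> U \<union> D - H"
  show "(\<forall>y\<in>H. density z \<le> density y) \<and> 2 < total_size H"
  proof (cases "z \<in> D")
    case True
    then show ?thesis using assms(2) z by (auto simp: density_greedy_def)
  next
    case False
    then have old: "\<forall>y\<in>B. density z \<le> density y" "2 < total_size B"
      using assms(1,3) z by (auto simp: density_greedy_def)
    have finH: "finite H" using fin assms(5) finite_subset by blast
    have posH: "\<forall>x\<in>H. 0 < item_size x" using pos assms(5) by blast
    show ?thesis
    proof (cases "B \<subseteq> H")
      case True
      have big: "2 < total_size H"
        using total_size_mono[OF finH True posH] old(2) by linarith
      have "density z \<le> density y" if y: "y \<in> H" for y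
      proof (rule ccontr)
        assume lt: "\<not> density z \<le> density y"
        have "B \<subseteq> {w \<in> H. density y < density w}" using True lt old(1) by force
        then have "total_size B \<le> total_size {w \<in> H. density y < density w}"
          using finH pos assms(5) by (intro total_size_mono) auto
        also have "\<dots> \<le> 2" using min y by blast
        finally show False using old(2) by simp
      qed
      with big show ?thesis by blast
    next
      case False
      \<comment> \<open>An old item \<open>x\<close> dropped in this round lies in between:
        \<open>z\<close> is no denser than \<open>x\<close>, and \<open>x\<close> is no denser than
        anything in \<open>H\<close>.\<close>
      then obtain x where x: "x \<in> B" "x \<in> D" "x \<notin> H" using assms(3) by blast
      then have "\<forall>y\<in>H. density x \<le> density y" "2 < total_size H"
        using assms(2) by (auto simp: density_greedy_def)
      with old(1) x show ?thesis by force
    qed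
  qed
qed

text \<open>Here the capacity \<open>1\<close> takes the place of a stopping rule. If all old items
  are kept, a newly kept \<open>y\<close> fits beside them although \<open>z\<close> does not, hence
  \<open>y\<close> is smaller than \<open>z\<close>. If an old item was dropped, its size lies
  between those of the kept items and that of \<open>z\<close>.\<close>

lemma size_greedy_step:
  assumes "size_greedy U B" and "size_greedy D G" and "B \<subseteq> D" "D \<subseteq> insert e B" "G \<subseteq> D"
    and one: "total_size G \<le> 1"
    and fin: "finite D" and pos: "\<forall>x\<in>D. 0 < item_size x"
  shows "size_greedy (U \<union> D) G"
  unfolding size_greedy_def
proof (intro ballI)
  fix z assume z: "z \<in> U \<union> D - G"
  show "(\<forall>y\<in>G. item_size y \<le> item_size z) \<and> 1 < total_size G + item_size z"
  proof (cases "z \<in> D")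
    case True
    then show ?thesis using assms(2) z by (auto simp: size_greedy_def)
  next
    case False
    then have old: "\<forall>y\<in>B. item_size y \<le> item_size z" "1 < total_size B + item_size z"
      using assms(1,3) z by (auto simp: size_greedy_def)
    have finG: "finite G" using fin assms(5) finite_subset by blast
    have posG: "\<forall>x\<in>G. 0 < item_size x" using pos assms(5) by blast
    show ?thesis
    proof (cases "B \<subseteq> G")
      case True
      have big: "1 < total_size G + item_size z"
        using total_size_mono[OF finG True posG] old(2) by linarith
      have "item_size y \<le> item_size z" if y: "y \<in> G" for y
      proof (cases "y \<in> B")
        case False
        have "finite B" using True finG finite_subset by blast
        then have "item_size y + total_size B \<le> total_size G"
          using total_size_mono[OF finG, of "insert y B"] True y posG total_size_insert[OF _ False]
          by simp
        with one old(2) show ?thesis by linarith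
      qed (use old in blast)
      with big show ?thesis by blast
    next
      case False
      then obtain x where x: "x \<in> B" "x \<in> D" "x \<notin> G" using assms(3) by blast
      then have "\<forall>y\<in>G. item_size y \<le> item_size x" "1 < total_size G + item_size x"
        using assms(2) by (auto simp: size_greedy_def)
      with old(1) x show ?thesis by force
    qed
  qed
qed

lemma is_AR_subset:
  assumes "is_AR R A" "valid_input es"
  shows "A es \<subseteq> set es"
  using assms(2)
proof (induction es rule: rev_induct)
  case Nil
  then show ?case using assms(1) by (simp add: is_AR_def)
next
  case (snoc e es)
  have "valid_input es" using snoc.prems by (auto simp: valid_input_def)
  moreover have "AR_step R (A es) e (A (es @ [e]))" using assms(1) snoc.prems by (simp add: is_AR_def)
  ultimately show ?case using AR_step_subset snoc.IH by fastforce
qed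

text \<open>\<open>V\<close> stays fixed through the induction, so a class meeting the condition
  meets it in every round and never loses its greedy form.\<close>

lemma is_AR_greedy:
  fixes R :: real
  defines "\<epsilon> \<equiv> buf_eps R"
  assumes R: "R \<ge> 3" and A: "is_AR R A" and "valid_input es" "\<forall>x\<in>set es. item_value x \<le> V"
  shows "density_greedy (set es \<inter> small_items \<epsilon>) (A es \<inter> small_items \<epsilon>)
    \<and> (\<forall>j. \<epsilon>\<^sup>2 * V < (1 + \<epsilon>) powi (j + 1) \<longrightarrow>
          size_greedy (set es \<inter> medium_class \<epsilon> j) (A es \<inter> medium_class \<epsilon> j))"
  using assms(4,5)
proof (induction es rule: rev_induct)
  case Nil
  then show ?case by (simp add: density_greedy_def size_greedy_def)
next
  case (snoc e es)
  let ?S = "small_items \<epsilon>" and ?M = "medium_class \<epsilon>"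
  have valid: "valid_input es" using snoc.prems by (auto simp: valid_input_def)
  have IH: "density_greedy (set es \<inter> ?S) (A es \<inter> ?S)"
    "\<epsilon>\<^sup>2 * V < (1 + \<epsilon>) powi (j + 1) \<Longrightarrow> size_greedy (set es \<inter> ?M j) (A es \<inter> ?M j)" for j
    using snoc.IH[OF valid] snoc.prems(2) by auto
  have sub: "A es \<subseteq> set es" by (rule is_AR_subset[OF A valid])
  then have fin: "finite (A es)" using finite_subset by blast
  have step: "AR_step R (A es) e (A (es @ [e]))" using A snoc.prems(1) by (simp add: is_AR_def)
  have pos: "\<forall>x\<in>A es \<union> {e}. 0 < item_size x" and nonneg: "\<forall>x\<in>A es \<union> {e}. 0 \<le> item_value x"
    and leV: "\<forall>x\<in>A es \<union> {e}. item_value x \<le> V"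
    using snoc.prems sub by (auto simp: valid_input_def)
  note greedy = AR_step_greedy[OF R step fin pos nonneg, folded \<epsilon>_def]
  note sub' = AR_step_subset[OF step]
  \<comment> \<open>The items seen are those seen earlier together with those at hand, the shape in
    which the one-round lemmas extend the invariant.\<close>
  have U: "set (es @ [e]) \<inter> X = (set es \<inter> X) \<union> ((A es \<union> {e}) \<inter> X)" for X using sub by auto
  have "density_greedy (set (es @ [e]) \<inter> ?S) (A (es @ [e]) \<inter> ?S)"
    unfolding U by (rule density_greedy_step[OF IH(1) greedy(2) _ _ _ greedy(3)])
      (use fin pos sub' in auto)
  moreover have "size_greedy (set (es @ [e]) \<inter> ?M j) (A (es @ [e]) \<inter> ?M j)"
    if j: "\<epsilon>\<^sup>2 * V < (1 + \<epsilon>) powi (j + 1)" for j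
    unfolding U by (rule size_greedy_step[OF IH(2)[OF j] greedy(5)[OF leV j] _ _ _ greedy(4)])
      (use fin pos sub' in auto)
  ultimately show ?case by blast
qed

section \<open>Copying an optimal packing from the buffer\<close>

text \<open>The smallest discarded item of \<open>X\<close>, of size \<open>t\<close>, separates the
  two sides: kept items have size at most \<open>t\<close>, items of \<open>X - G\<close> at least
  \<open>t\<close>. So exchanging equal numbers never adds size, and only the supply in
  \<open>G - X\<close> has to be counted.\<close>

lemma size_greedy_exchange:
  assumes "finite U" and "G \<subseteq> U" "X \<subseteq> U" and "size_greedy U G" "total_size X \<le> 1"
    and pos: "\<forall>x\<in>U. 0 < item_size x"
  obtains Y where "Y \<subseteq> G" "card Y = card X" "total_size Y \<le> total_size X"
proof (cases "X \<subseteq> G")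
  case True
  with that show thesis by blast
next
  case False
  have fin: "finite G" "finite X" using assms(1-3) finite_subset by blast+
  have "finite (X - G)" "X - G \<noteq> {}" using False fin by auto
  then obtain x where x: "x \<in> X - G" and xmin: "\<And>z. z \<in> X - G \<Longrightarrow> item_size x \<le> item_size z"
    using ex_is_arg_min_if_finite[of "X - G" item_size] by (metis is_arg_min_linorder)
  have G: "\<forall>y\<in>G. item_size y \<le> item_size x" "1 < total_size G + item_size x"
    using assms(3,4) x by (auto simp: size_greedy_def)
  define t where "t = item_size x"
  have X: "total_size X = total_size (X \<inter> G) + total_size (X - G)"
    using fin total_size_Un_disjoint[of "X \<inter> G" "X - G"] by (simp add: Int_Diff_Un Int_Diff_disjoint)
  have GX: "total_size G = total_size (X \<inter> G) + total_size (G - X)"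
    using fin total_size_Un_disjoint[of "X \<inter> G" "G - X"]
    by (metis Diff_disjoint Int_Diff_Un Int_commute finite_Diff finite_Int Int_Diff_disjoint)
  have lower: "real (card (X - G)) * t \<le> total_size (X - G)"
    unfolding total_size_def t_def using xmin by (intro sum_bounded_below)
  have upper: "total_size Z \<le> real (card Z) * t" if "Z \<subseteq> G" for Z
    unfolding total_size_def t_def using G(1) that by (intro sum_bounded_above) auto
  have card: "card (X - G) \<le> card (G - X)"
  proof (rule ccontr)
    assume "\<not> card (X - G) \<le> card (G - X)"
    \<comment> \<open>With fewer items in \<open>G - X\<close>, the item \<open>x\<close> of
      \<open>X - G\<close> can be spared; then \<open>G\<close> together with \<open>x\<close> is no
      larger than \<open>X\<close>, although it overflows the knapsack.\<close>
    then have c: "card (G - X) \<le> card (X - G - {x})" using x fin by simp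
    have "0 \<le> t" using pos x assms(3) by (force simp: t_def)
    with c have "real (card (G - X)) * t \<le> real (card (X - G - {x})) * t"
      by (intro mult_right_mono) auto
    also have "\<dots> \<le> total_size (X - G - {x})"
      unfolding total_size_def t_def using xmin by (intro sum_bounded_below) auto
    also have "\<dots> = total_size (X - G) - t"
      using x fin by (simp add: total_size_def t_def sum_diff1)
    finally show False using upper[of "G - X"] X GX G(2) assms(5) unfolding t_def by force
  qed
  then obtain Z where Z: "Z \<subseteq> G - X" "card Z = card (X - G)" "finite Z"
    using obtain_subset_with_card_n by metis
  let ?Y = "(X \<inter> G) \<union> Z"
  have "card ?Y = card X"
    using Z fin by (subst card_Un_disjoint) (auto simp: card_Diff_subset_Int Int_commute card_mono)
  moreover have "total_size ?Y \<le> total_size X"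
  proof -
    have "total_size Z \<le> real (card (X - G)) * t" using upper[of Z] Z by auto
    moreover have "total_size ?Y = total_size (X \<inter> G) + total_size Z"
      using Z fin by (intro total_size_Un_disjoint) auto
    ultimately show ?thesis using lower X by linarith
  qed
  ultimately show thesis using that[of ?Y] Z(1) by auto
qed

text \<open>A set of greatest cardinality between \<open>T\<close> and \<open>D\<close> within
  capacity \<open>c\<close> works: if it is not all of \<open>D\<close>, one more item overflows
  \<open>c\<close>, and that item has size at most \<open>\<epsilon>\<close>.\<close>

lemma fill_small:
  assumes fin: "finite D" and "T \<subseteq> D" "total_size T \<le> c" "c \<le> total_size D" "0 < \<epsilon>"
    and small: "\<forall>x\<in>D. item_size x \<le> \<epsilon>"
  obtains H where "T \<subseteq> H" "H \<subseteq> D" "total_size H \<le> c" "c - \<epsilon> < total_size H"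
proof -
  let ?P = "\<lambda>H. T \<subseteq> H \<and> H \<subseteq> D \<and> total_size H \<le> c"
  have "\<exists>H. ?P H \<and> (\<forall>K. ?P K \<longrightarrow> card K \<le> card H)"
    using assms by (intro ex_has_greatest_nat[of ?P T card "Suc (card D)"]) (auto simp: less_Suc_eq_le intro: card_mono)
  then obtain H where H: "?P H" "\<And>K. ?P K \<Longrightarrow> card K \<le> card H" by blast
  have finH: "finite H" using H(1) fin finite_subset by blast
  have "c - \<epsilon> < total_size H"
  proof (cases "H = D")
    case False
    then obtain z where z: "z \<in> D" "z \<notin> H" using H(1) by blast
    then have "\<not> ?P (insert z H)" using H(2)[of "insert z H"] finH by auto
    then have "c < item_size z + total_size H"
      using z H(1) total_size_insert[OF finH z(2)] by auto
    then show ?thesis using small z(1) by fastforce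
  qed (use assms in auto)
  with H(1) that show thesis by blast
qed

text \<open>The kept items of \<open>X\<close> stay, and further kept small items fill the room up
  to within \<open>\<epsilon>\<close> of \<open>c\<close>. These are at least as dense as the
  discarded part of \<open>X\<close>, so only the gap costs value: at most \<open>\<epsilon>\<close>
  times the density of \<open>x\<close>, the densest discarded item of \<open>X\<close>.\<close>

lemma density_greedy_packing:
  assumes finU: "finite U" and "G \<subseteq> U" "X \<subseteq> U" and greedy: "density_greedy U G"
    and items: "\<forall>x\<in>U. 0 < item_size x \<and> item_size x \<le> \<epsilon> \<and> 0 \<le> item_value x"
    and eps: "0 < \<epsilon>" "\<epsilon> \<le> 1/2" and c: "total_size X \<le> c" "c \<le> 1"
    and V: "\<And>Y. \<lbrakk>Y \<subseteq> G; total_size Y \<le> 1\<rbrakk> \<Longrightarrow> total_value Y \<le> V"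
  obtains Y where "Y \<subseteq> G" "total_size Y \<le> c" "total_value X - 2 * \<epsilon> * V \<le> total_value Y"
proof (cases "X \<subseteq> G")
  case True
  have "0 \<le> V" using V[of "{}"] by (simp add: total_value_def)
  then show thesis using that[of X] True c(1) eps(1) by simp
next
  case False
  have fin: "finite G" "finite X" using assms(1-3) finite_subset by blast+
  have "finite (X - G)" "X - G \<noteq> {}" using False fin by auto
  then obtain x where x: "x \<in> X - G" and xmax: "\<And>z. z \<in> X - G \<Longrightarrow> density z \<le> density x"
    using ex_is_arg_min_if_finite[of "X - G" "\<lambda>x. - density x"]
    by (metis is_arg_min_linorder neg_le_iff_le)
  have G: "\<forall>y\<in>G. density x \<le> density y" "2 < total_size G"
    using assms(3) x greedy by (auto simp: density_greedy_def)
  have nonneg: "0 \<le> density x"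
    using items x assms(3) by (auto simp: density_def intro!: divide_nonneg_pos)
  have value_eq: "total_value Y = (\<Sum>y\<in>Y. density y * item_size y)" if "Y \<subseteq> U" for Y
    unfolding total_value_def density_def
  proof (intro sum.cong refl)
    fix y assume "y \<in> Y"
    then have "0 < item_size y" using items that by blast
    then show "item_value y = item_value y / item_size y * item_size y" by simp
  qed
  have lower: "density x * total_size Y \<le> total_value Y" if "Y \<subseteq> G" for Y
  proof -
    have YU: "Y \<subseteq> U" using that assms(2) by blast
    show ?thesis
      unfolding value_eq[OF YU] total_size_def sum_distrib_left
      using G(1) items that YU by (intro sum_mono mult_right_mono) (auto intro: less_imp_le)
  qed
  have XU: "X - G \<subseteq> U" using assms(3) by blast
  have upper: "total_value (X - G) \<le> density x * total_size (X - G)"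
    unfolding value_eq[OF XU] total_size_def sum_distrib_left
    using xmax items XU by (intro sum_mono mult_right_mono) (auto intro: less_imp_le)
  have smallG: "\<forall>y\<in>G. item_size y \<le> \<epsilon>" using items assms(2) by blast
  \<comment> \<open>A packing of load above \<open>1 - \<epsilon> \<ge> 1/2\<close> by items at
    least as dense as \<open>x\<close> is worth at most \<open>V\<close>; this bounds the density of
    \<open>x\<close> by \<open>2 * V\<close>.\<close>
  obtain Y1 where Y1: "Y1 \<subseteq> G" "total_size Y1 \<le> 1" "1 - \<epsilon> < total_size Y1"
    by (rule fill_small[OF fin(1) empty_subsetI _ _ eps(1) smallG, of 1]) (use G(2) in auto)
  have "density x * (1/2) \<le> density x * total_size Y1"
    using nonneg Y1(3) eps(2) by (intro mult_left_mono) auto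
  also have "\<dots> \<le> V" using lower[OF Y1(1)] V[OF Y1(1,2)] by linarith
  finally have dV: "density x \<le> 2 * V" by simp
  have "total_size (X \<inter> G) \<le> total_size X"
    using fin(2) items assms(3) by (intro total_size_mono) auto
  then have "total_size (X \<inter> G) \<le> c" "c \<le> total_size G" using c G(2) by auto
  with fill_small[OF fin(1) Int_lower2 this eps(1) smallG]
  obtain Y where Y: "X \<inter> G \<subseteq> Y" "Y \<subseteq> G" "total_size Y \<le> c" "c - \<epsilon> < total_size Y"
    by blast
  have finY: "finite Y" using Y(2) fin(1) finite_subset by blast
  have splitX: "X = (X \<inter> G) \<union> (X - G)" "(X \<inter> G) \<inter> (X - G) = {}" by auto
  have splitY: "Y = (X \<inter> G) \<union> (Y - X \<inter> G)" "(X \<inter> G) \<inter> (Y - X \<inter> G) = {}" using Y(1) by auto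
  have X: "total_size X = total_size (X \<inter> G) + total_size (X - G)"
    "total_value X = total_value (X \<inter> G) + total_value (X - G)"
    using total_size_Un_disjoint[OF _ _ splitX(2)] total_value_Un_disjoint[OF _ _ splitX(2)]
      fin splitX(1) by auto
  have YS: "total_size Y = total_size (X \<inter> G) + total_size (Y - X \<inter> G)"
    "total_value Y = total_value (X \<inter> G) + total_value (Y - X \<inter> G)"
    using total_size_Un_disjoint[OF _ _ splitY(2)] total_value_Un_disjoint[OF _ _ splitY(2)]
      fin finY splitY(1) by auto
  have "density x * (total_size (X - G) - \<epsilon>) \<le> density x * total_size (Y - X \<inter> G)"
    using X(1) YS(1) Y(4) c(1) nonneg by (intro mult_left_mono) auto
  also have "\<dots> \<le> total_value (Y - X \<inter> G)" using Y(2) by (intro lower) blast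
  finally have "total_value (X - G) - density x * \<epsilon> \<le> total_value (Y - X \<inter> G)"
    using upper by (simp add: algebra_simps)
  moreover have "density x * \<epsilon> \<le> 2 * V * \<epsilon>" using dV eps(1) by (intro mult_right_mono) auto
  ultimately have "total_value X - 2 * \<epsilon> * V \<le> total_value Y"
    using X(2) YS(2) by (simp add: algebra_simps)
  with Y(2,3) that show thesis by blast
qed

text \<open>Items of value at most \<open>\<epsilon>\<^sup>2 * V\<close> are dropped;
  \<open>X\<close> has at most \<open>1 / \<epsilon>\<close> items, so this loses at most
  \<open>\<epsilon> * V\<close>. Every other item lies in a class on which the buffer is greedy, and
  exchanging within a class costs a factor \<open>1 + \<epsilon>\<close>.\<close>

lemma size_greedy_packing:
  assumes finU: "finite U" and "B \<subseteq> U" "X \<subseteq> U" and size_X: "total_size X \<le> 1"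
    and items: "\<forall>x\<in>U. 0 < item_size x \<and> 0 \<le> item_value x"
    and medium: "\<forall>x\<in>X. \<epsilon> < item_size x" and eps: "0 < \<epsilon>" and V: "0 \<le> V"
    and greedy: "\<And>j. \<epsilon>\<^sup>2 * V < (1 + \<epsilon>) powi (j + 1) \<Longrightarrow>
      size_greedy (U \<inter> medium_class \<epsilon> j) (B \<inter> medium_class \<epsilon> j)"
  obtains Y where "Y \<subseteq> B" "\<forall>y\<in>Y. \<epsilon> < item_size y" "total_size Y \<le> total_size X"
    "total_value X - \<epsilon> * V \<le> (1 + \<epsilon>) * total_value Y"
proof -
  let ?M = "medium_class \<epsilon>"
  define N where "N = {x \<in> X. item_value x \<le> \<epsilon>\<^sup>2 * V}"
  define J where "J = (\<lambda>x. \<lfloor>log (1 + \<epsilon>) (item_value x)\<rfloor>) ` (X - N)"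
  have finX: "finite X" and finB: "finite B" using assms(1-3) finite_subset by blast+
  have finJ: "finite J" unfolding J_def using finX by simp
  have disj: "?M i \<inter> ?M k = {}" if "i \<noteq> k" for i k
    using disjoint_medium_class[OF eps] that by (auto simp: disjoint_family_on_def)
  have in_class: "x \<in> ?M \<lfloor>log (1 + \<epsilon>) (item_value x)\<rfloor>" if "x \<in> X - N" for x
  proof -
    have "0 \<le> \<epsilon>\<^sup>2 * V" using V by simp
    then have "0 < item_value x" using that by (auto simp: N_def)
    then show ?thesis using that medium medium_class_iff[OF eps] by auto
  qed
  have "\<exists>Y. Y \<subseteq> B \<inter> ?M j \<and> card Y = card (X \<inter> ?M j) \<and> total_size Y \<le> total_size (X \<inter> ?M j)"
    if "j \<in> J" for j
  proof -
    obtain x where x: "x \<in> X - N" "x \<in> ?M j" using \<open>j \<in> J\<close> in_class unfolding J_def by blast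
    \<comment> \<open>An item above the cut forces only the upper end of its class above
      \<open>\<epsilon>\<^sup>2 * V\<close>, not the lower one; hence the exponent
      \<open>j + 1\<close>.\<close>
    then have "\<epsilon>\<^sup>2 * V < (1 + \<epsilon>) powi (j + 1)" by (auto simp: N_def medium_class_def)
    moreover have "total_size (X \<inter> ?M j) \<le> 1"
      using total_size_mono[OF finX, of "X \<inter> ?M j"] items assms(3) size_X by force
    ultimately show ?thesis
      using size_greedy_exchange[of "U \<inter> ?M j" "B \<inter> ?M j" "X \<inter> ?M j"] greedy assms(1-3) items
      by (metis IntD1 Int_mono finite_Int order_refl)
  qed
  then obtain Y where Y: "Y j \<subseteq> B \<inter> ?M j" "card (Y j) = card (X \<inter> ?M j)"
      "total_size (Y j) \<le> total_size (X \<inter> ?M j)" if "j \<in> J" for j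
    by metis
  have finY: "finite (Y j)" if "j \<in> J" for j
    using Y(1)[OF that] finB by (meson finite_Int finite_subset)
  have sum_Y: "(\<Sum>y\<in>(\<Union>j\<in>J. Y j). f y) = (\<Sum>j\<in>J. \<Sum>y\<in>Y j. f y)" for f :: "item \<Rightarrow> real"
  proof (rule sum.UNION_disjoint[OF finJ])
    show "\<forall>i\<in>J. \<forall>j\<in>J. i \<noteq> j \<longrightarrow> Y i \<inter> Y j = {}" using Y(1) disj by blast
  qed (use finY in blast)
  have sum_X: "(\<Sum>x\<in>(\<Union>j\<in>J. X \<inter> ?M j). f x) = (\<Sum>j\<in>J. \<Sum>x\<in>X \<inter> ?M j. f x)" for f :: "item \<Rightarrow> real"
  proof (rule sum.UNION_disjoint[OF finJ])
    show "\<forall>i\<in>J. \<forall>j\<in>J. i \<noteq> j \<longrightarrow> (X \<inter> ?M i) \<inter> (X \<inter> ?M j) = {}" using disj by blast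
  qed (use finX in blast)
  have "total_size (\<Union>j\<in>J. Y j) \<le> total_size (\<Union>j\<in>J. X \<inter> ?M j)"
    unfolding total_size_def sum_Y sum_X using Y(3) by (intro sum_mono) (simp add: total_size_def)
  also have "\<dots> \<le> total_size X"
    using finX items assms(3) by (intro total_size_mono) auto
  finally have size_le: "total_size (\<Union>j\<in>J. Y j) \<le> total_size X" .
  have class_value: "total_value (X \<inter> ?M j) \<le> (1 + \<epsilon>) * total_value (Y j)" if "j \<in> J" for j
  proof -
    \<comment> \<open>The upper end of the class is played against its lower end, with equally many
      items on both sides.\<close>
    have "total_value (X \<inter> ?M j) \<le> real (card (X \<inter> ?M j)) * (1 + \<epsilon>) powi (j + 1)"
      unfolding total_value_def by (intro sum_bounded_above) (auto simp: medium_class_def)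
    also have "\<dots> = (1 + \<epsilon>) * (real (card (Y j)) * (1 + \<epsilon>) powi j)"
      using eps Y(2)[OF that] by (simp add: power_int_add)
    also have "\<dots> \<le> (1 + \<epsilon>) * total_value (Y j)"
      unfolding total_value_def using Y(1)[OF that] eps
      by (intro mult_left_mono sum_bounded_below) (auto simp: medium_class_def)
    finally show ?thesis .
  qed
  have "total_value (\<Union>j\<in>J. X \<inter> ?M j) = (\<Sum>j\<in>J. total_value (X \<inter> ?M j))"
    unfolding total_value_def by (rule sum_X)
  also have "\<dots> \<le> (\<Sum>j\<in>J. (1 + \<epsilon>) * total_value (Y j))"
    using class_value by (intro sum_mono)
  also have "\<dots> = (1 + \<epsilon>) * total_value (\<Union>j\<in>J. Y j)"
    unfolding total_value_def sum_Y by (simp add: sum_distrib_left)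
  finally have value_ge: "total_value (\<Union>j\<in>J. X \<inter> ?M j) \<le> (1 + \<epsilon>) * total_value (\<Union>j\<in>J. Y j)" .
  have "real (card N) * \<epsilon> \<le> total_size N"
    unfolding total_size_def using medium by (intro sum_bounded_below) (auto simp: N_def)
  also have "\<dots> \<le> total_size X"
    using finX items assms(3) by (intro total_size_mono) (auto simp: N_def)
  finally have card_N: "real (card N) * \<epsilon> \<le> 1" using size_X by linarith
  have "total_value N \<le> real (card N) * (\<epsilon>\<^sup>2 * V)"
    unfolding total_value_def by (intro sum_bounded_above) (auto simp: N_def)
  also have "\<dots> = (real (card N) * \<epsilon>) * (\<epsilon> * V)" by (simp add: power2_eq_square)
  also have "\<dots> \<le> 1 * (\<epsilon> * V)" using card_N eps V by (intro mult_right_mono) auto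
  finally have N: "total_value N \<le> \<epsilon> * V" by simp
  \<comment> \<open>Only an inclusion: the classes indexed by \<open>J\<close> may also contain
    items of \<open>N\<close>, whose values are then counted twice, which is harmless for an upper
    bound.\<close>
  have XN: "X - N \<subseteq> (\<Union>j\<in>J. X \<inter> ?M j)" using in_class unfolding J_def by blast
  have "total_value X = total_value N + total_value (X - N)"
    using total_value_Un_disjoint[of N "X - N"] finX by (simp add: N_def Un_absorb1)
  moreover have "total_value (X - N) \<le> total_value (\<Union>j\<in>J. X \<inter> ?M j)"
    using XN finJ finX items assms(3) by (intro total_value_mono) auto
  ultimately have "total_value X - \<epsilon> * V \<le> (1 + \<epsilon>) * total_value (\<Union>j\<in>J. Y j)"
    using N value_ge by linarith
  moreover have "(\<Union>j\<in>J. Y j) \<subseteq> B" "\<forall>y\<in>(\<Union>j\<in>J. Y j). \<epsilon> < item_size y"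
    using Y(1) by (auto simp: medium_class_def)
  ultimately show thesis using that size_le by blast
qed

text \<open>Medium items are replaced first. Their replacements need no more room, so at least the
  room of the small part of \<open>X\<close> remains, and all of it is offered to small items. The
  two additive losses sum to \<open>3 * \<epsilon> * V\<close>.\<close>

lemma greedy_packing:
  fixes \<epsilon> :: real
  assumes finU: "finite U" and BU: "B \<subseteq> U" and eps: "0 < \<epsilon>" "\<epsilon> \<le> 1/8"
    and items: "\<forall>x\<in>U. 0 < item_size x \<and> 0 \<le> item_value x"
    and small: "density_greedy (U \<inter> small_items \<epsilon>) (B \<inter> small_items \<epsilon>)"
    and medium: "\<And>j. \<epsilon>\<^sup>2 * best_packing U < (1 + \<epsilon>) powi (j + 1) \<Longrightarrow>
      size_greedy (U \<inter> medium_class \<epsilon> j) (B \<inter> medium_class \<epsilon> j)"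
  shows "best_packing U \<le> (1 + 8 * \<epsilon>) * best_packing B"
proof -
  define V where "V = best_packing U"
  let ?S = "small_items \<epsilon>"
  obtain X where X: "X \<subseteq> U" "total_size X \<le> 1" "total_value X = V"
    using best_packing_attained[OF finU] unfolding V_def by blast
  have finX: "finite X" and finB: "finite B" using X(1) BU finU finite_subset by blast+
  have V: "0 \<le> V" using best_packing_ge[OF finU, of "{}"] by (simp add: V_def total_value_def)
  have split: "X = (X \<inter> ?S) \<union> (X - ?S)" "(X \<inter> ?S) \<inter> (X - ?S) = {}" by auto
  have XS: "total_size X = total_size (X \<inter> ?S) + total_size (X - ?S)"
    "total_value X = total_value (X \<inter> ?S) + total_value (X - ?S)"
    using total_size_Un_disjoint[OF _ _ split(2)] total_value_Un_disjoint[OF _ _ split(2)]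
      finX split(1) by auto
  have "0 \<le> total_size (X \<inter> ?S)"
    unfolding total_size_def using items X(1) by (intro sum_nonneg) (auto intro: less_imp_le)
  then have "total_size (X - ?S) \<le> 1" using X(2) XS(1) by linarith
  moreover have "X - ?S \<subseteq> U" using X(1) by blast
  moreover have "\<forall>x\<in>X - ?S. \<epsilon> < item_size x" by (auto simp: small_items_def)
  ultimately obtain Y where Y: "Y \<subseteq> B" "\<forall>y\<in>Y. \<epsilon> < item_size y" "total_size Y \<le> total_size (X - ?S)"
    "total_value (X - ?S) - \<epsilon> * V \<le> (1 + \<epsilon>) * total_value Y"
    using size_greedy_packing[OF finU BU _ _ items _ eps(1) V medium[folded V_def], of "X - ?S"]
    by blast
  have finY: "finite Y" using Y(1) finB finite_subset by blast
  have "0 \<le> total_size Y"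
    unfolding total_size_def using items Y(1) BU by (intro sum_nonneg) (auto intro: less_imp_le)
  then have c: "total_size (X \<inter> ?S) \<le> 1 - total_size Y" "1 - total_size Y \<le> 1"
    using Y(3) XS(1) X(2) by linarith+
  obtain Z where Z: "Z \<subseteq> B \<inter> ?S" "total_size Z \<le> 1 - total_size Y"
    "total_value (X \<inter> ?S) - 2 * \<epsilon> * V \<le> total_value Z"
  proof (rule density_greedy_packing[OF _ _ _ small _ eps(1) _ c])
    fix W assume "W \<subseteq> B \<inter> ?S" "total_size W \<le> 1"
    then show "total_value W \<le> V" unfolding V_def using BU by (intro best_packing_ge finU) auto
  qed (use finU BU X(1) items eps in \<open>auto simp: small_items_def\<close>)
  have finZ: "finite Z" using Z(1) finB by (meson finite_Int finite_subset)
  have YZ: "Y \<inter> Z = {}" using Y(2) Z(1) by (force simp: small_items_def)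
  have "total_size (Y \<union> Z) \<le> 1"
    using total_size_Un_disjoint[OF finY finZ YZ] Z(2) by linarith
  then have P: "total_value Y + total_value Z \<le> best_packing B"
    using best_packing_ge[OF finB, of "Y \<union> Z"] Y(1) Z(1) total_value_Un_disjoint[OF finY finZ YZ]
    by auto
  have "0 \<le> total_value Z"
    unfolding total_value_def using items Z(1) BU by (intro sum_nonneg) auto
  \<comment> \<open>The factor is applied to the small items as well, so that it can be taken out of
    the sum.\<close>
  then have "total_value Z \<le> (1 + \<epsilon>) * total_value Z" using mult_right_mono[of 1 "1 + \<epsilon>"] eps(1) by simp
  then have "V - 3 * \<epsilon> * V \<le> (1 + \<epsilon>) * (total_value Y + total_value Z)"
    using Y(4) Z(3) XS(2) X(3) by (simp add: algebra_simps)
  also have "\<dots> \<le> (1 + \<epsilon>) * best_packing B" using P eps(1) by (intro mult_left_mono) auto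
  finally have main: "(1 - 3 * \<epsilon>) * V \<le> (1 + \<epsilon>) * best_packing B" by (simp add: algebra_simps)
  \<comment> \<open>The right-hand side is
    \<open>1 + 5 * \<epsilon> - 24 * \<epsilon>\<^sup>2\<close>, and
    \<open>\<epsilon> \<le> 1/8\<close> gives
    \<open>24 * \<epsilon>\<^sup>2 \<le> 3 * \<epsilon>\<close>.\<close>
  have "1 + \<epsilon> \<le> (1 + 8 * \<epsilon>) * (1 - 3 * \<epsilon>)"
    using mult_left_mono[OF eps(2), of \<epsilon>] eps(1) by (simp add: algebra_simps)
  moreover have "0 \<le> best_packing B"
    using best_packing_ge[OF finB, of "{}"] by (simp add: total_value_def)
  ultimately have "(1 + \<epsilon>) * best_packing B \<le> (1 + 8 * \<epsilon>) * (1 - 3 * \<epsilon>) * best_packing B"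
    by (rule mult_right_mono)
  with main have "(1 - 3 * \<epsilon>) * V \<le> (1 - 3 * \<epsilon>) * ((1 + 8 * \<epsilon>) * best_packing B)"
    by (simp add: mult_ac)
  then show ?thesis
    unfolding V_def using eps(2) by (simp add: mult_le_cancel_left)
qed

section \<open>The size of \<open>buf_eps R\<close> and the competitive ratio\<close>

text \<open>\<open>buf_eps R\<close> solves \<open>ln (1 / x) = m * ln (1 + x)\<close>, whose left
  side decreases and whose right side increases in \<open>x\<close>; so it suffices that at
  \<open>t = 8 * ln R / R\<close> the right side is no smaller than the left. The constant
  \<open>8\<close> comes from \<open>m \<ge> R / 4\<close> and
  \<open>ln (1 + t) \<ge> t / 2\<close>, which make the right side at least
  \<open>R * t / 8 = ln R\<close>.\<close>

lemma buf_eps_le: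
  assumes R: "R \<ge> 10" and le1: "8 * ln R / R \<le> 1"
  shows "buf_eps R \<le> 8 * ln R / R"
proof (rule ccontr)
  define t where "t = 8 * ln R / R"
  define k where "k = nat (buf_m R)"
  assume "\<not> buf_eps R \<le> 8 * ln R / R"
  then have less: "t < buf_eps R" by (simp add: t_def)
  note eps = buf_eps_props[of R]
  have k: "real_of_int (buf_m R) = real k" "R / 4 \<le> real k"
  proof -
    have "(R - 3) / 2 - 1 < real_of_int (buf_m R)" unfolding buf_m_def by linarith
    \<comment> \<open>\<open>R \<ge> 10\<close> is exactly what makes \<open>(R - 3) / 2 - 1\<close>
      at least \<open>R / 4\<close>.\<close>
    then have "R / 4 \<le> real_of_int (buf_m R)" using R by (simp add: field_simps)
    moreover from this have "0 \<le> buf_m R" using R by linarith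
    ultimately show "real_of_int (buf_m R) = real k" "R / 4 \<le> real k"
      unfolding k_def by simp_all
  qed
  have t01: "0 < t" "t \<le> 1" using R le1 by (auto simp: t_def)
  have "ln (1 / buf_eps R) = real k * ln (1 + buf_eps R)"
    using eps R k(1) by (auto simp: log_def field_simps)
  moreover have "ln (1 / buf_eps R) \<le> ln (1 / t)"
    using less t01 by (simp add: frac_le)
  moreover have "real k * ln (1 + t) < real k * ln (1 + buf_eps R)"
    using less t01 k(2) R by (intro mult_strict_left_mono) auto
  ultimately have upper: "real k * ln (1 + t) < ln (1 / t)" by linarith
  have "t / 2 \<le> ln (1 + t)"
  proof -
    have "t / 2 \<le> t / (1 + t)" using t01 by (intro divide_left_mono) auto
    also have "\<dots> \<le> ln (1 + t)" using ln_add1_ge[of t] t01 by (simp add: add.commute)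
    finally show ?thesis .
  qed
  then have "R / 4 * (t / 2) \<le> real k * ln (1 + t)"
    using k(2) R t01 by (intro mult_mono) auto
  moreover have "R / 4 * (t / 2) = ln R" using R by (simp add: t_def)
  moreover have "ln (1 / t) \<le> ln R"
  proof -
    \<comment> \<open>This makes \<open>1 / t = R / (8 * ln R)\<close> at most
      \<open>R\<close>.\<close>
    have "1 \<le> ln R" using exp_le R by (subst ln_ge_iff) auto
    then have "1 / t \<le> R" using R by (simp add: t_def field_simps)
    then show ?thesis using t01 R by simp
  qed
  ultimately show False using upper by linarith
qed

text \<open>The constant is \<open>64 = 8 * 8\<close>, from the ratio
  \<open>1 + 8 * \<epsilon>\<close> and the bound \<open>8 * ln R / R\<close> on
  \<open>\<epsilon>\<close>. The capacity is a maximum because the load bound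
  \<open>2 * m + 3 + \<epsilon>\<close> may exceed \<open>R\<close>, by at most
  \<open>\<epsilon>\<close>. Quantifying over all \<open>A\<close> with \<open>is_AR R A\<close>
  covers every way of breaking ties.\<close>

theorem theorem8:
  shows "\<exists>C > 0 :: real. \<exists>R0 \<ge> 3 :: real. \<forall>R \<ge> R0. \<forall>A. is_AR R A \<longrightarrow>
           removable_algorithm (max R (2 * real_of_int (buf_m R) + 3 + buf_eps R)) A \<and>
           competitive (1 + C * (ln R / R)) A"
proof -
  \<comment> \<open>The threshold \<open>1/8\<close> is the one that \<open>greedy_packing\<close>
    needs for \<open>\<epsilon>\<close>.\<close>
  have "eventually (\<lambda>R::real. 8 * ln R / R \<le> 1/8) at_top" by real_asymp
  then obtain R1 where R1: "\<And>R::real. R \<ge> R1 \<Longrightarrow> 8 * ln R / R \<le> 1/8"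
    by (auto simp: eventually_at_top_linorder)
  have "removable_algorithm (max R (2 * real_of_int (buf_m R) + 3 + buf_eps R)) A \<and>
      competitive (1 + 64 * (ln R / R)) A" if R: "R \<ge> max R1 10" and A: "is_AR R A" for R A
  proof
    let ?\<epsilon> = "buf_eps R"
    have R3: "R \<ge> 3" and R10: "R \<ge> 10" and "R \<ge> R1" using R by auto
    have R8: "8 * ln R / R \<le> 1/8" by (rule R1[OF \<open>R \<ge> R1\<close>])
    have eps: "0 < ?\<epsilon>" "?\<epsilon> \<le> 8 * ln R / R"
      using buf_eps_props[OF R3] buf_eps_le[OF R10] R8 by auto
    have "A (es @ [e]) \<subseteq> A es \<union> {e} \<and> total_size (A (es @ [e])) \<le> 2 * real_of_int (buf_m R) + 3 + ?\<epsilon>"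
      if valid: "valid_input (es @ [e])" for es e
    proof -
      have step: "AR_step R (A es) e (A (es @ [e]))" using A valid by (simp add: is_AR_def)
      have "valid_input es" using valid by (auto simp: valid_input_def)
      note sub = is_AR_subset[OF A this]
      have "total_size (A (es @ [e])) \<le> 2 * real_of_int (buf_m R) + 3 + ?\<epsilon>"
      proof (rule AR_step_greedy(1)[OF R3 step])
        show "finite (A es)" using sub finite_subset by blast
      qed (use sub valid in \<open>auto simp: valid_input_def\<close>)
      with AR_step_subset[OF step] show ?thesis by blast
    qed
    then show "removable_algorithm (max R (2 * real_of_int (buf_m R) + 3 + ?\<epsilon>)) A"
      using A by (force simp: removable_algorithm_def is_AR_def)
    show "competitive (1 + 64 * (ln R / R)) A"
      unfolding competitive_def OPT_def ALG_def
    proof (intro allI impI)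
      fix es assume valid: "valid_input es"
      \<comment> \<open>A single item fits into the knapsack, so the optimum can serve as the bound
        \<open>V\<close> of the invariant.\<close>
      have leV: "\<forall>x\<in>set es. item_value x \<le> best_packing (set es)"
      proof
        fix x assume "x \<in> set es"
        then show "item_value x \<le> best_packing (set es)"
          using best_packing_ge[of "set es" "{x}"] valid
          by (simp add: valid_input_def total_size_def total_value_def)
      qed
      note sub = is_AR_subset[OF A valid]
      then have finA: "finite (A es)" using finite_subset by blast
      have "best_packing (set es) \<le> (1 + 8 * ?\<epsilon>) * best_packing (A es)"
        using is_AR_greedy[OF R3 A valid leV] valid eps R8 sub
        by (intro greedy_packing) (auto simp: valid_input_def)
      also have "\<dots> \<le> (1 + 64 * (ln R / R)) * best_packing (A es)"
        using eps(2) best_packing_ge[OF finA, of "{}"]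
        by (intro mult_right_mono) (auto simp: total_value_def)
      finally show "best_packing (set es) \<le> (1 + 64 * (ln R / R)) * best_packing (A es)" .
    qed
  qed
  then show ?thesis by (intro exI[of _ 64] conjI exI[of _ "max R1 10"]) auto
qed

end
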